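(* Let $n\ge 1$, let $w\in\mathfrak S_n$ and let $I\subseteq J(w)$, where $J(w)=\{j\in[n-1]: w^{-1}(j)>w^{-1}(j+1)\}$. Write $D=[n-1]\setminus I=\{d_1<d_2<\dots<d_k\}$, $d_0:=0$, $d_{k+1}:=n$. Then the following two conditions are equivalent. (a) $w_0(I)\,w$ is a standard Coxeter element of some parabolic subgroup of $\mathfrak S_n$. (b) There exists a reduced expression $w=s_{i_1}s_{i_2}\cdots s_{i_{\ell(w)}}$ such that (S.1) for each $1\le i\le k$, $s_{d_i}$ appears at most once in it, i.e. $\#\{m: i_m=d_i\}\le 1$; and (S.2) $\#\{m: d_{t-1}<i_m<d_t\}<\binom{d_t-d_{t-1}+1}{2}$ for all $1\le t\le k+1$.
   Context: $\mathfrak S_n$ is the symmetric group on $[n]=\{1,\dots,n\}$, generated by the simple transpositions $s_i=(i\ i{+}1)$, $1\le i\le n-1$; $\ell$ is Coxeter length. Subsets of $[n-1]$ are identified with subsets of $\{s_1,\dots,s_{n-1}\}$. For $K\subseteq[n-1]$, $W_K$ is the parabolic subgroup generated by $\{s_i:i\in K\}$; a standard Coxeter element of $W_K$ is any product of the elements $s_i$, $i\in K$, each used exactly once, in some order (the identity if $K=\emptyset$). $w_0(I)$ is the longest element of $W_I$. *)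

theory Defs
  imports "HOL-Combinatorics.Permutations" "HOL-Algebra.Sym_Groups"
begin

text \<open>
  The symmetric group on \<open>{1..n}\<close> is \<^term>\<open>sym_group n\<close>: its elements are the functions
  \<open>nat \<Rightarrow> nat\<close> that permute \<open>{1..n}\<close> and fix every other number, and its product is composition
  of functions, so in a product the rightmost factor acts first. With this convention
  \<open>left_descents\<close> below is the set of \<open>j\<close> for which multiplying by \<open>s\<^sub>j\<close> on the left
  shortens \<open>w\<close>.
\<close>

definition simple_transposition :: "nat \<Rightarrow> nat \<Rightarrow> nat" where
  "simple_transposition i = Transposition.transpose i (i + 1)"

definition word_product :: "nat list \<Rightarrow> nat \<Rightarrow> nat" where
  "word_product is = foldr (\<lambda>i u. simple_transposition i \<circ> u) is id"

definition coxeter_length :: "nat \<Rightarrow> (nat \<Rightarrow> nat) \<Rightarrow> nat" where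
  "coxeter_length n w =
     (LEAST l. \<exists>is. set is \<subseteq> {1..<n} \<and> length is = l \<and> word_product is = w)"

definition reduced_expression :: "nat \<Rightarrow> nat list \<Rightarrow> (nat \<Rightarrow> nat) \<Rightarrow> bool" where
  "reduced_expression n is w \<longleftrightarrow>
     set is \<subseteq> {1..<n} \<and> word_product is = w \<and> length is = coxeter_length n w"

definition parabolic_subgroup :: "nat \<Rightarrow> nat set \<Rightarrow> (nat \<Rightarrow> nat) set" where
  "parabolic_subgroup n K = generate (sym_group n) (simple_transposition ` K)"

text \<open>
  A finite Coxeter group has exactly one element of maximal length, so the choice made by
  \<^const>\<open>arg_max\<close> is determined.
\<close>

definition longest_element :: "nat \<Rightarrow> nat set \<Rightarrow> nat \<Rightarrow> nat" where
  "longest_element n K = (ARG_MAX (coxeter_length n) u. u \<in> parabolic_subgroup n K)"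

text \<open>
  A Coxeter element of the parabolic subgroup attached to \<open>K\<close> is described by the generating
  set \<open>K\<close> itself, as the definition refers to the generators.
\<close>

definition standard_coxeter_element :: "nat set \<Rightarrow> (nat \<Rightarrow> nat) \<Rightarrow> bool" where
  "standard_coxeter_element K c \<longleftrightarrow>
     (\<exists>is. distinct is \<and> set is = K \<and> word_product is = c)"

definition left_descents :: "nat \<Rightarrow> (nat \<Rightarrow> nat) \<Rightarrow> nat set" where
  "left_descents n w = {j \<in> {1..<n}. inv' w j > inv' w (j + 1)}"

end

theory Submission
  imports Defs
begin

text \<open>
  If \<open>w\<^sub>0(I) w = c\<close> is a Coxeter element, the inclusion of \<open>I\<close> in the descent set makes
  \<open>w = w\<^sub>0(I) c\<close> length additive. A reduced word of \<open>w\<^sub>0(I)\<close> followed by one of \<open>c\<close> is then a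
  reduced word of \<open>w\<close>. A block with \<open>L\<close> letters receives \<open>L (L + 1) / 2\<close> letters from the first factor
  and at most \<open>L\<close> from the second.

  Conversely, let \<open>r\<close> be a reduced word of \<open>w\<close> as in (b). Multiplying by the letters of
  \<open>w\<^sub>0(I)\<close> one at a time deletes one letter of \<open>r\<close> each time, by the exchange property. Since every
  \<open>s\<^sub>d\<close> with \<open>d\<close> outside \<open>I\<close> occurs at most once, the deleted letter lies in the same block as the
  multiplying letter. The remaining word \<open>v\<close> of \<open>w\<^sub>0(I) w\<close> therefore has at most \<open>L\<close> letters in each
  block with \<open>L\<close> letters, and \<open>w\<^sub>0(I) w\<close> has no left descent in \<open>I\<close>. If all letters of a block
  occur in \<open>v\<close>, each occurs once. If some letter is missing, the strands of the block on either side of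
  it never cross each other; at most one strand enters from outside, and it moves monotonically, so
  no letter is used twice.
\<close>

section \<open>Words, exchange and reducedness\<close>

lemma simple_transposition_apply:
  "simple_transposition i x = (if x = i then Suc i else if x = Suc i then i else x)"
  by (simp add: simple_transposition_def Transposition.transpose_def)

lemma simple_transposition_twice [simp]:
  "simple_transposition i (simple_transposition i x) = x"
  by (simp add: simple_transposition_apply)

lemma word_product_Nil [simp]: "word_product [] = id"
  by (simp add: word_product_def)

lemma word_product_Cons [simp]:
  "word_product (i # xs) = simple_transposition i \<circ> word_product xs"
  by (simp add: word_product_def)

lemma word_product_append [simp]: "word_product (xs @ ys) = word_product xs \<circ> word_product ys"
  by (induction xs) (simp_all add: comp_assoc)

lemma word_product_rev_left [simp]: "word_product (rev xs) (word_product xs x) = x"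
  by (induction xs arbitrary: x) simp_all

lemma word_product_rev_right [simp]: "word_product xs (word_product (rev xs) x) = x"
  using word_product_rev_left[of "rev xs"] by simp

lemma inv_word_product: "inv' (word_product xs) = word_product (rev xs)"
  by (rule inv_equality) simp_all

lemma word_product_eq_iff [simp]: "word_product xs x = word_product xs y \<longleftrightarrow> x = y"
  by (metis word_product_rev_left)

lemma word_product_rev_cong:
  assumes "word_product xs = word_product ys"
  shows "word_product (rev xs) = word_product (rev ys)"
  using assms by (metis inv_word_product)

text \<open>Only \<open>d\<close> moves a point across the cut between \<open>d\<close> and
  \<open>d + 1\<close>; every other letter maps each side of the cut to itself.\<close>

lemma word_product_le_iff:
  assumes "d \<notin> set xs"
  shows "word_product xs x \<le> d \<longleftrightarrow> x \<le> d"
  using assms by (induction xs) (auto simp: simple_transposition_apply)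

text \<open>The pair \<open>a\<close>, \<open>b\<close> is followed through the letters from left to
  right. Its order can only change at a letter that swaps the two current values, which are then
  adjacent. The pair is arbitrary because adjacency is lost along the way.\<close>

lemma exchange_split:
  assumes "a < b" "word_product (rev xs) a > word_product (rev xs) b"
  shows "\<exists>us x vs. xs = us @ x # vs \<and> word_product us x = a \<and> word_product us (Suc x) = b"
  using assms
proof (induction xs arbitrary: a b)
  case Nil
  then show ?case by simp
next
  case (Cons y ys)
  let ?s = "simple_transposition y"
  show ?case
  proof (cases "a = y \<and> b = Suc y")
    case True
    then have "y # ys = [] @ y # ys \<and> word_product [] y = a \<and> word_product [] (Suc y) = b"
      by simp
    then show ?thesis by blast
  next
    case False
    then have "?s a < ?s b" using Cons.prems(1) by (auto simp: simple_transposition_apply)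
    moreover have "word_product (rev ys) (?s a) > word_product (rev ys) (?s b)"
      using Cons.prems(2) by simp
    ultimately obtain us x vs where "ys = us @ x # vs" "word_product us x = ?s a"
      "word_product us (Suc x) = ?s b"
      using Cons.IH by blast
    then have "y # ys = (y # us) @ x # vs \<and> word_product (y # us) x = a
      \<and> word_product (y # us) (Suc x) = b"
      by simp
    then show ?thesis by blast
  qed
qed

text \<open>Conjugating the transposition of \<open>x\<close> and \<open>x + 1\<close> by the
  product of \<open>us\<close> gives that of \<open>j\<close> and \<open>j + 1\<close>, so the
  letter \<open>x\<close> cancels against the factor on the left.\<close>

lemma exchange_delete:
  assumes "word_product us x = j" "word_product us (Suc x) = Suc j"
  shows "word_product (us @ vs) = simple_transposition j \<circ> word_product (us @ x # vs)"
proof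
  fix y
  have "simple_transposition j (word_product us z) = word_product us (simple_transposition x z)" for z
    using assms word_product_eq_iff[of us z x] word_product_eq_iff[of us z "Suc x"]
    by (auto simp: simple_transposition_apply)
  then show "word_product (us @ vs) y = (simple_transposition j \<circ> word_product (us @ x # vs)) y"
    by simp
qed

text \<open>The images of \<open>x\<close> and \<open>x + 1\<close> under \<open>us\<close> are kept
  in the conclusion because they later determine the block of the deleted letter.\<close>

lemma exchange:
  assumes "word_product (rev xs) j > word_product (rev xs) (Suc j)"
  obtains us x vs where "xs = us @ x # vs" "word_product us x = j" "word_product us (Suc x) = Suc j"
    "word_product (us @ vs) = simple_transposition j \<circ> word_product xs"
  using exchange_split[OF lessI assms] exchange_delete by metis

text \<open>A recursive form of reducedness: each letter, prepended to the suffix after it, meets an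
  ascent of the inverse of that suffix and so lengthens it.\<close>

primrec ascending :: "nat list \<Rightarrow> bool" where
  "ascending [] \<longleftrightarrow> True"
| "ascending (i # xs) \<longleftrightarrow>
     word_product (rev xs) i < word_product (rev xs) (Suc i) \<and> ascending xs"

lemma ascending_appendD: "ascending (xs @ ys) \<Longrightarrow> ascending ys"
  by (induction xs) auto

text \<open>The first letter \<open>i\<close> is a left descent of the product, so exchange deletes
  a letter from any competitor \<open>ys\<close> and leaves a word for the tail.\<close>

lemma ascending_minimal:
  assumes "ascending xs" "word_product ys = word_product xs"
  shows "length xs \<le> length ys"
  using assms
proof (induction xs arbitrary: ys)
  case Nil
  then show ?case by simp
next
  case (Cons i xs)
  have "word_product (rev ys) = word_product (rev (i # xs))"
    using Cons.prems(2) by (rule word_product_rev_cong)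
  then have "word_product (rev ys) i > word_product (rev ys) (Suc i)"
    using Cons.prems(1) by (simp add: simple_transposition_apply)
  then obtain us x vs where *: "ys = us @ x # vs"
    "word_product (us @ vs) = simple_transposition i \<circ> word_product ys"
    by (rule exchange)
  then have "word_product (us @ vs) = word_product xs"
    using Cons.prems(2) by (auto simp: fun_eq_iff)
  then have "length xs \<le> length (us @ vs)" using Cons.IH[of "us @ vs"] Cons.prems(1) by simp
  then show ?case using * by simp
qed

text \<open>At the innermost failure \<open>i # xs\<close>, exchange cancels \<open>i\<close>
  against a letter of \<open>xs\<close>. No new letters arise, so the shorter word stays in the same
  parabolic subgroup.\<close>

lemma not_ascending_shorten:
  assumes "\<not> ascending xs"
  shows "\<exists>ys. set ys \<subseteq> set xs \<and> word_product ys = word_product xs \<and> length ys < length xs"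
  using assms
proof (induction xs)
  case Nil
  then show ?case by simp
next
  case (Cons i xs)
  show ?case
  proof (cases "ascending xs")
    case True
    then have "\<not> word_product (rev xs) i < word_product (rev xs) (Suc i)"
      using Cons.prems by simp
    then have "word_product (rev xs) i > word_product (rev xs) (Suc i)"
      using word_product_eq_iff[of "rev xs" i "Suc i"] by linarith
    then obtain us x vs where *: "xs = us @ x # vs"
      "word_product (us @ vs) = simple_transposition i \<circ> word_product xs"
      by (rule exchange)
    then show ?thesis by (intro exI[of _ "us @ vs"]) auto
  next
    case False
    then obtain ys where "set ys \<subseteq> set xs" "word_product ys = word_product xs"
      "length ys < length xs"
      using Cons.IH by blast
    then show ?thesis by (intro exI[of _ "i # ys"]) auto
  qed
qed

lemma ascending_word_exists:
  "\<exists>ys. set ys \<subseteq> set xs \<and> word_product ys = word_product xs \<and> ascending ys"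
proof (induction "length xs" arbitrary: xs rule: less_induct)
  case less
  show ?case
  proof (cases "ascending xs")
    case False
    then obtain ys where ys: "set ys \<subseteq> set xs" "word_product ys = word_product xs"
      "length ys < length xs"
      using not_ascending_shorten by blast
    then obtain zs where "set zs \<subseteq> set ys" "word_product zs = word_product ys" "ascending zs"
      using less by blast
    then show ?thesis using ys by auto
  qed auto
qed

lemma coxeter_length_le:
  assumes "set xs \<subseteq> {1..<n}"
  shows "coxeter_length n (word_product xs) \<le> length xs"
  unfolding coxeter_length_def by (rule Least_le) (use assms in auto)

lemma coxeter_length_ascending:
  assumes "set xs \<subseteq> {1..<n}" "ascending xs"
  shows "coxeter_length n (word_product xs) = length xs"
  unfolding coxeter_length_def
  by (rule Least_equality) (use assms ascending_minimal in auto)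

lemma reduced_expression_iff_ascending:
  "reduced_expression n xs w \<longleftrightarrow> set xs \<subseteq> {1..<n} \<and> word_product xs = w \<and> ascending xs"
proof (cases "set xs \<subseteq> {1..<n} \<and> word_product xs = w")
  case True
  have "ascending xs" if "length xs = coxeter_length n w"
  proof (rule ccontr)
    assume "\<not> ascending xs"
    then obtain ys where "set ys \<subseteq> set xs" "word_product ys = w" "length ys < length xs"
      using not_ascending_shorten True by blast
    moreover from this have "coxeter_length n w \<le> length ys"
      using coxeter_length_le True by blast
    ultimately show False using that by simp
  qed
  then show ?thesis
    using True coxeter_length_ascending by (auto simp: reduced_expression_def)
qed (auto simp: reduced_expression_def)

section \<open>Letters in a block\<close>

definition block_count :: "nat \<Rightarrow> nat \<Rightarrow> nat list \<Rightarrow> nat" where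
  "block_count p q xs = length (filter (\<lambda>i. p < i \<and> i < q) xs)"

lemma block_count_simps [simp]:
  "block_count p q [] = 0"
  "block_count p q (i # xs) = (if p < i \<and> i < q then 1 else 0) + block_count p q xs"
  "block_count p q (xs @ ys) = block_count p q xs + block_count p q ys"
  "block_count p q (rev xs) = block_count p q xs"
  by (simp_all add: block_count_def rev_filter[symmetric])

lemma block_count_conv_sum: "block_count p q xs = (\<Sum>i\<in>{p<..<q}. count_list xs i)"
proof (induction xs)
  case (Cons x xs)
  have "(\<Sum>i\<in>{p<..<q}. count_list (x # xs) i)
      = (\<Sum>i\<in>{p<..<q}. (if x = i then 1 else 0) + count_list xs i)"
    by (rule sum.cong) auto
  also have "\<dots> = (if p < x \<and> x < q then 1 else 0) + (\<Sum>i\<in>{p<..<q}. count_list xs i)"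
    by (simp add: sum.distrib)
  finally show ?case using Cons by simp
qed simp

text \<open>As \<open>p\<close> and \<open>q\<close> are absent, the word permutes the points in
  \<open>{p<..q}\<close>. A prepended block letter creates exactly one inversion among them; any
  other letter fixes them all.\<close>

lemma block_count_conv_inversions:
  assumes "ascending xs" "p \<notin> set xs" "q \<notin> set xs"
  shows "block_count p q xs =
    card {(a, b). p < a \<and> a < b \<and> b \<le> q \<and> word_product (rev xs) a > word_product (rev xs) b}"
  using assms
proof (induction xs)
  case Nil
  have *: "{(a, b). p < a \<and> a < b \<and> b \<le> q \<and> b < a} = {}" by auto
  show ?case unfolding rev.simps word_product_Nil id_apply * by simp
next
  case (Cons j xs)
  let ?s = "simple_transposition j"
  define inversions where "inversions g = {(a, b). p < a \<and> a < b \<and> b \<le> q \<and> g a > g b}"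
    for g :: "nat \<Rightarrow> nat"
  let ?g = "word_product (rev xs)"
  have fin: "finite (inversions g)" for g
    by (rule finite_subset[of _ "{..q} \<times> {..q}"]) (auto simp: inversions_def)
  have IH: "block_count p q xs = card (inversions ?g)"
    using Cons by (simp add: inversions_def)
  have asc: "?g j < ?g (Suc j)" and ne: "j \<noteq> p" "j \<noteq> q" using Cons.prems by auto
  have "block_count p q (j # xs) = card (inversions (?g \<circ> ?s))"
  proof (cases "p < j \<and> j < q")
    case True
    let ?m = "map_prod ?s ?s"
    have m2: "?m (?m z) = z" for z by (cases z) simp
    \<comment> \<open>\<open>?s\<close> preserves the order of every increasing pair except
      \<open>(j, j + 1)\<close>, so it carries the old inversions to the remaining new ones.\<close>
    have "inversions (?g \<circ> ?s) = insert (j, Suc j) (?m ` inversions ?g)"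
    proof (intro Set.set_eqI iffI)
      fix z assume z: "z \<in> inversions (?g \<circ> ?s)"
      obtain a b where ab: "z = (a, b)" "p < a" "a < b" "b \<le> q" "?g (?s a) > ?g (?s b)"
        using z by (auto simp: inversions_def)
      have "?m z \<in> inversions ?g" if "z \<noteq> (j, Suc j)"
      proof -
        have "?s a < ?s b" "p < ?s a" "?s b \<le> q"
          using ab(1-4) that True by (auto simp: simple_transposition_apply)
        then show ?thesis using ab(1,5) by (simp add: inversions_def)
      qed
      then show "z \<in> insert (j, Suc j) (?m ` inversions ?g)"
        using m2 by (metis image_eqI insertCI)
    next
      fix z assume "z \<in> insert (j, Suc j) (?m ` inversions ?g)"
      then consider "z = (j, Suc j)" | a b where "z = ?m (a, b)" "(a, b) \<in> inversions ?g"
        by auto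
      then show "z \<in> inversions (?g \<circ> ?s)"
      proof cases
        case 1
        then show ?thesis using True asc by (simp add: inversions_def simple_transposition_apply)
      next
        case 2
        then have "\<not> (a = j \<and> b = Suc j)" using asc by (auto simp: inversions_def)
        then have "?s a < ?s b" "p < ?s a" "?s b \<le> q"
          using 2 True by (auto simp: inversions_def simple_transposition_apply)
        then show ?thesis using 2 by (simp add: inversions_def)
      qed
    qed
    moreover have "(j, Suc j) \<notin> ?m ` inversions ?g"
      by (auto simp: inversions_def simple_transposition_apply split: if_splits)
    moreover have "inj_on ?m (inversions ?g)" using m2 by (metis inj_onI)
    ultimately show ?thesis using True IH fin by (simp add: card_image)
  next
    case False
    then have "?s a = a" if "p < a" "a \<le> q" for a
      using that ne by (auto simp: simple_transposition_apply)
    then have "inversions (?g \<circ> ?s) = inversions ?g" by (auto simp: inversions_def)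
    then show ?thesis using False IH by auto
  qed
  then show ?case by (simp add: inversions_def)
qed

lemma card_increasing_pairs: "card {(a, b). p < a \<and> a < b \<and> b \<le> q} = (q - p) choose 2"
  for p q :: nat
proof (induction q)
  case 0
  have *: "{(a, b). p < a \<and> a < b \<and> b \<le> (0::nat)} = {}" by auto
  show ?case unfolding * by simp
next
  case (Suc q)
  let ?A = "{(a, b). p < a \<and> a < b \<and> b \<le> q}"
  have eq: "{(a, b). p < a \<and> a < b \<and> b \<le> Suc q} = ?A \<union> {p<..<Suc q} \<times> {Suc q}" by auto
  have "finite ?A" by (rule finite_subset[of _ "{..q} \<times> {..q}"]) auto
  then have "card {(a, b). p < a \<and> a < b \<and> b \<le> Suc q} = card ?A + (q - p)"
    unfolding eq by (subst card_Un_disjoint) (auto simp: card_cartesian_product)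
  also have "\<dots> = (Suc q - p) choose 2"
    using Suc by (cases "p \<le> q") (auto simp: Suc_diff_le numeral_2_eq_2)
  finally show ?case .
qed

section \<open>Stripping descents from a word\<close>

text \<open>
  \<open>us\<close> carries \<open>{x, x + 1}\<close> to \<open>{j, j + 1}\<close>. A single letter \<open>d\<close> moves only one point across the
  cut between \<open>d\<close> and \<open>d + 1\<close>, so both pairs lie on the same side of the cut.
\<close>

lemma exchange_same_side:
  assumes "word_product us x = j" "word_product us (Suc x) = Suc j"
    and "count_list (us @ [x]) d \<le> 1" "d \<noteq> j"
  shows "x \<noteq> d \<and> (d < x \<longleftrightarrow> d < j)"
proof (cases "d \<in> set us")
  case False
  then show ?thesis
    using word_product_le_iff[OF False, of x] word_product_le_iff[OF False, of "Suc x"] assms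
    by auto
next
  case True
  then have "x \<noteq> d" using assms(3) by (auto simp: count_list_0_iff)
  have "count_list us d = Suc 0"
    using True assms(3) count_list_0_iff[of us d] by (simp split: if_splits)
  then obtain us1 us2 where us: "us = us1 @ d # us2" "d \<notin> set us1" "d \<notin> set us2"
    using count_list_Suc_split_first[of us d 0] by (auto simp: count_list_0_iff)
  \<comment> \<open>The positions of the pair just before the single \<open>d\<close> acts. Both lie
    on one side of the cut and both end on one side; \<open>d\<close> could not move two distinct
    points across in the same direction.\<close>
  define y z where yz: "y = word_product us2 x" "z = word_product us2 (Suc x)"
  have side: "y \<le> d \<longleftrightarrow> x \<le> d" "z \<le> d \<longleftrightarrow> x \<le> d" "y \<noteq> z"
    unfolding yz
    using word_product_le_iff[OF us(3), of x] word_product_le_iff[OF us(3), of "Suc x"] \<open>x \<noteq> d\<close>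
    by auto
  have "simple_transposition d y \<le> d \<longleftrightarrow> j \<le> d" "simple_transposition d z \<le> d \<longleftrightarrow> Suc j \<le> d"
    using word_product_le_iff[OF us(2)] assms(1,2) unfolding us(1) yz
    by (metis comp_apply word_product_append word_product_Cons)+
  then show ?thesis
    using side \<open>x \<noteq> d\<close> \<open>d \<noteq> j\<close> by (auto simp: simple_transposition_apply split: if_splits)
qed

text \<open>Every \<open>c\<close> outside \<open>I\<close> is a wall that the word respects. The
  lemma also serves for \<open>a > b\<close>, where the assumed interval is empty.\<close>

lemma word_product_block:
  assumes "set xs \<subseteq> I" "{a..<b} \<subseteq> I"
  shows "{word_product xs a..<word_product xs b} \<subseteq> I"
proof
  fix c assume c: "c \<in> {word_product xs a..<word_product xs b}"
  show "c \<in> I"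
  proof (rule ccontr)
    assume "c \<notin> I"
    then have "c \<notin> set xs" using assms(1) by auto
    then have "a \<le> c" "c < b"
      using c word_product_le_iff[of c xs a] word_product_le_iff[of c xs b] by auto
    then show False using \<open>c \<notin> I\<close> assms(2) by auto
  qed
qed

lemma descents_imp_decreasing:
  fixes g :: "nat \<Rightarrow> nat"
  assumes "\<forall>j\<in>I. g j > g (Suc j)" "{a..<b} \<subseteq> I" "a < b"
  shows "g a > g b"
  using assms(2,3)
proof (induction b)
  case (Suc b)
  have "b \<in> I" using Suc.prems by auto
  then have "g b > g (Suc b)" using assms(1) by blast
  moreover have "g a > g b" if "a < b"
    using Suc.prems(1) by (intro Suc.IH that) auto
  ultimately show ?case using Suc.prems(2) by (cases "a = b") auto
qed simp

text \<open>One application of exchange per letter of \<open>us\<close>. The counts stand behind an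
  implication because the length statement is also applied to words whose letters outside
  \<open>I\<close> are not bounded.\<close>

lemma strip_descents:
  assumes "ascending us" "set us \<subseteq> I"
    and "\<forall>j\<in>I. word_product (rev xs) j > word_product (rev xs) (Suc j)"
  shows "\<exists>ys. word_product ys = word_product us \<circ> word_product xs
    \<and> length ys + length us = length xs \<and> set ys \<subseteq> set xs
    \<and> ((\<forall>d. d \<notin> I \<longrightarrow> count_list xs d \<le> 1) \<longrightarrow> (\<forall>d. d \<notin> I \<longrightarrow> count_list ys d \<le> 1)
      \<and> (\<forall>p q. p \<notin> I \<longrightarrow> q \<notin> I \<longrightarrow>
          block_count p q ys + block_count p q us = block_count p q xs))"
  using assms(1,2)
proof (induction us)
  case Nil
  show ?case by (rule exI[of _ xs]) simp
next
  case (Cons j us)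
  then have "ascending us" "set us \<subseteq> I" by auto
  from Cons.IH[OF this] obtain ys where ys: "word_product ys = word_product us \<circ> word_product xs"
    "length ys + length us = length xs" "set ys \<subseteq> set xs"
    "(\<forall>d. d \<notin> I \<longrightarrow> count_list xs d \<le> 1) \<longrightarrow> (\<forall>d. d \<notin> I \<longrightarrow> count_list ys d \<le> 1)
      \<and> (\<forall>p q. p \<notin> I \<longrightarrow> q \<notin> I \<longrightarrow>
          block_count p q ys + block_count p q us = block_count p q xs)"
    by (elim exE conjE) (rule that)
  have "j \<in> I" using Cons.prems by simp
  have "word_product (rev ys) = word_product (rev xs) \<circ> word_product (rev us)"
    using word_product_rev_cong[of ys "us @ xs"] ys(1) by simp
  \<comment> \<open>The inverse of \<open>us\<close> ascends at \<open>j\<close> and both values lie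
    within one block, where the inverse of \<open>xs\<close> is decreasing. The composite therefore
    descends at \<open>j\<close>, as exchange requires.\<close>
  moreover have "{word_product (rev us) j..<word_product (rev us) (Suc j)} \<subseteq> I"
    using word_product_block[of "rev us" I j "Suc j"] Cons.prems by auto
  ultimately have "word_product (rev ys) j > word_product (rev ys) (Suc j)"
    using descents_imp_decreasing[OF assms(3)] Cons.prems(1) by auto
  then obtain us' x vs where e: "ys = us' @ x # vs" "word_product us' x = j"
    "word_product us' (Suc x) = Suc j"
    "word_product (us' @ vs) = simple_transposition j \<circ> word_product ys"
    by (rule exchange)
  have "(\<forall>d. d \<notin> I \<longrightarrow> count_list (us' @ vs) d \<le> 1)
      \<and> (\<forall>p q. p \<notin> I \<longrightarrow> q \<notin> I \<longrightarrow>
          block_count p q (us' @ vs) + block_count p q (j # us) = block_count p q xs)"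
    if "\<forall>d. d \<notin> I \<longrightarrow> count_list xs d \<le> 1"
  proof -
    have c: "count_list ys d \<le> 1" if "d \<notin> I" for d
      using ys(4) \<open>\<forall>d. d \<notin> I \<longrightarrow> count_list xs d \<le> 1\<close> that by blast
    have le: "count_list (us' @ vs) d \<le> count_list ys d" "count_list (us' @ [x]) d \<le> count_list ys d"
      for d using e(1) by auto
    \<comment> \<open>The deleted letter and \<open>j\<close> lie on the same side of every
      \<open>d\<close> outside \<open>I\<close>, hence in the same block.\<close>
    have "x \<noteq> d \<and> (d < x \<longleftrightarrow> d < j)" if "d \<notin> I" for d
      by (rule exchange_same_side[OF e(2,3)]) (use le(2)[of d] c[OF that] that \<open>j \<in> I\<close> in auto)
    then have "p < x \<and> x < q \<longleftrightarrow> p < j \<and> j < q" if "p \<notin> I" "q \<notin> I" for p q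
      using that \<open>j \<in> I\<close> by (metis linorder_neqE_nat not_less_iff_gr_or_eq)
    then have "block_count p q (us' @ vs) + block_count p q (j # us) = block_count p q ys + block_count p q us"
      if "p \<notin> I" "q \<notin> I" for p q
      using that e(1) by auto
    moreover have "count_list (us' @ vs) d \<le> 1" if "d \<notin> I" for d
      using le(1)[of d] c[OF that] by linarith
    ultimately show ?thesis using ys(4) \<open>\<forall>d. d \<notin> I \<longrightarrow> count_list xs d \<le> 1\<close> by metis
  qed
  then show ?case using ys e by (intro exI[of _ "us' @ vs"]) (auto simp: comp_assoc)
qed

section \<open>Longest elements\<close>

lemma simple_transposition_permutes:
  assumes "i \<in> {1..<n}"
  shows "simple_transposition i permutes {1..n}"
  unfolding simple_transposition_def using assms by (intro permutes_swap_id) auto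

lemma inv_simple_transposition [simp]: "inv' (simple_transposition i) = simple_transposition i"
  by (simp add: simple_transposition_def)

text \<open>The generators are involutions, so words in them already contain all inverses.\<close>

lemma parabolic_subgroup_conv_words:
  assumes "K \<subseteq> {1..<n}"
  shows "parabolic_subgroup n K = word_product ` {xs. set xs \<subseteq> K}"
proof (intro Set.set_eqI iffI)
  fix u assume "u \<in> parabolic_subgroup n K"
  then have "u \<in> generate (sym_group n) (simple_transposition ` K)"
    by (simp add: parabolic_subgroup_def)
  then show "u \<in> word_product ` {xs. set xs \<subseteq> K}"
  proof induction
    case one
    show ?case by (rule image_eqI[of _ _ "[]"]) (auto simp: sym_group_one)
  next
    case (incl h)
    then obtain i where "i \<in> K" "h = simple_transposition i" by blast
    then show ?case by (intro image_eqI[of _ _ "[i]"]) auto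
  next
    case (inv h)
    then obtain i where i: "i \<in> K" "h = simple_transposition i" by blast
    then have "h \<in> carrier (sym_group n)"
      using assms simple_transposition_permutes by (auto simp: sym_group_carrier)
    then show ?case using i by (intro image_eqI[of _ _ "[i]"]) auto
  next
    case (eng h1 h2)
    then obtain xs ys where "set xs \<subseteq> K" "set ys \<subseteq> K" "h1 = word_product xs" "h2 = word_product ys"
      by blast
    then show ?case by (intro image_eqI[of _ _ "xs @ ys"]) (auto simp: sym_group_mult)
  qed
next
  fix u assume "u \<in> word_product ` {xs. set xs \<subseteq> K}"
  then obtain xs where "set xs \<subseteq> K" "u = word_product xs" by blast
  moreover have "set xs \<subseteq> K \<Longrightarrow> word_product xs \<in> generate (sym_group n) (simple_transposition ` K)"
  proof (induction xs)
    case Nil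
    show ?case using generate.one[of "sym_group n"] by (simp add: sym_group_one id_def)
  next
    case (Cons i xs)
    then have "simple_transposition i \<in> generate (sym_group n) (simple_transposition ` K)"
      by (intro generate.incl) auto
    moreover have "word_product xs \<in> generate (sym_group n) (simple_transposition ` K)"
      using Cons by simp
    ultimately have "simple_transposition i \<otimes>\<^bsub>sym_group n\<^esub> word_product xs
        \<in> generate (sym_group n) (simple_transposition ` K)"
      by (rule generate.eng)
    then show ?case by (simp add: sym_group_mult comp_def)
  qed
  ultimately show "u \<in> parabolic_subgroup n K" by (simp add: parabolic_subgroup_def)
qed

lemma word_product_permutes:
  assumes "set xs \<subseteq> {1..<n}"
  shows "word_product xs permutes {1..n}"
  using assms
proof (induction xs)
  case Nil
  show ?case using permutes_id by (simp add: id_def)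
next
  case (Cons i xs)
  then show ?case
    unfolding word_product_Cons by (intro permutes_compose simple_transposition_permutes) auto
qed

text \<open>If some \<open>j\<close> in \<open>I\<close> were not a left descent, prepending it
  would give a longer reduced word in the same subgroup.\<close>

lemma longest_element_word:
  assumes "I \<subseteq> {1..<n}"
  obtains xs where "ascending xs" "set xs \<subseteq> I" "word_product xs = longest_element n I"
    "\<forall>j\<in>I. word_product (rev xs) j > word_product (rev xs) (Suc j)"
proof -
  let ?P = "parabolic_subgroup n I" and ?l = "coxeter_length n"
  have "?P \<subseteq> {p. p permutes {1..n}}"
    using parabolic_subgroup_conv_words[OF assms] word_product_permutes assms by auto
  then have fin: "finite ?P" using finite_permutations[of "{1..n}"] finite_subset by blast
  \<comment> \<open>Finiteness supplies the strict upper bound under which \<open>ARG_MAX\<close> is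
    attained.\<close>
  have "\<forall>u. u \<in> ?P \<longrightarrow> ?l u < Suc (Max (?l ` ?P))"
    using fin by (simp add: less_Suc_eq_le)
  moreover have "id \<in> ?P"
    unfolding parabolic_subgroup_conv_words[OF assms] by (rule image_eqI[of _ _ "[]"]) auto
  ultimately have max: "longest_element n I \<in> ?P" "\<And>u. u \<in> ?P \<Longrightarrow> ?l u \<le> ?l (longest_element n I)"
    using arg_max_nat_lemma[of "\<lambda>u. u \<in> ?P"] unfolding longest_element_def by blast+
  obtain ys where "set ys \<subseteq> I" "word_product ys = longest_element n I"
    using max(1) parabolic_subgroup_conv_words[OF assms] by auto
  then obtain xs where xs: "ascending xs" "set xs \<subseteq> I" "word_product xs = longest_element n I"
    using ascending_word_exists[of ys] by auto
  have "word_product (rev xs) j > word_product (rev xs) (Suc j)" if "j \<in> I" for j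
  proof (rule ccontr)
    assume "\<not> ?thesis"
    then have "word_product (rev xs) j < word_product (rev xs) (Suc j)"
      using word_product_eq_iff[of "rev xs" j "Suc j"] by linarith
    then have "ascending (j # xs)" using xs(1) by simp
    then have "?l (word_product (j # xs)) = Suc (length xs)"
      using coxeter_length_ascending[of "j # xs" n] xs(2) that assms
      by (metis insert_subset length_Cons list.simps(15) order_trans)
    moreover have "?l (longest_element n I) = length xs"
      using coxeter_length_ascending[of xs n] xs assms by auto
    moreover have "word_product (j # xs) \<in> ?P"
      unfolding parabolic_subgroup_conv_words[OF assms]
      by (rule image_eqI[of _ _ "j # xs"]) (use xs(2) that in auto)
    ultimately show False using max(2)[of "word_product (j # xs)"] by simp
  qed
  then show thesis using that xs by blast
qed

section \<open>Letters between a missing letter and a rare one\<close>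

text \<open>The pair swapped by the first \<open>c\<close> is inverted, and the prefix without
  \<open>c\<close> keeps its members on opposite sides of the cut. Conversely, a cut that no
  inversion crosses has no letter in the word.\<close>

lemma ascending_reaches_inversion:
  assumes "ascending xs" "c \<in> set xs"
  shows "\<exists>a b. a \<le> c \<and> c < b \<and> word_product (rev xs) a > word_product (rev xs) b"
proof -
  obtain us vs where us: "xs = us @ c # vs" "c \<notin> set us"
    using split_list_first[OF assms(2)] by blast
  let ?a = "word_product us c" and ?b = "word_product us (Suc c)"
  have "word_product (rev vs) c < word_product (rev vs) (Suc c)"
    using ascending_appendD[of us "c # vs"] assms(1) us(1) by simp
  then have "word_product (rev xs) ?a > word_product (rev xs) ?b"
    unfolding us(1) by (simp add: simple_transposition_apply)
  moreover have "?a \<le> c" "c < ?b"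
    using word_product_le_iff[OF us(2), of c] word_product_le_iff[OF us(2), of "Suc c"] by auto
  ultimately show ?thesis by blast
qed

lemma ascents_imp_increasing:
  fixes g :: "nat \<Rightarrow> nat"
  assumes "\<And>j. a \<le> j \<Longrightarrow> j < b \<Longrightarrow> g j < g (Suc j)" "a < b"
  shows "g a < g b"
  using assms
proof (induction b)
  case (Suc b)
  have "g b < g (Suc b)" using Suc.prems by auto
  moreover have "g a < g b" if "a < b" using Suc that by auto
  ultimately show ?case using Suc.prems(2) by (cases "a = b") auto
qed simp

text \<open>
  Only the first letter \<open>c + 1\<close> of the interval can be a descent. After it has been removed from the
  front, the inverse permutation fixes \<open>c + 1\<close>, so that letter does not occur again and the situation
  repeats on the shorter interval that starts at \<open>c + 1\<close>.
\<close>

lemma count_le_1_isolated_interval: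
  assumes "ascending xs" "c \<notin> set xs" "i \<notin> set xs"
    and "\<And>j. Suc c < j \<Longrightarrow> j < i \<Longrightarrow> word_product (rev xs) j < word_product (rev xs) (Suc j)"
    and "c < j" "j < i"
  shows "count_list xs j \<le> 1"
  using assms
proof (induction xs arbitrary: c j)
  case Nil
  then show ?case by simp
next
  case (Cons x xs)
  let ?g = "word_product (rev xs)"
  let ?g' = "word_product (rev (x # xs))"
  have g': "?g' y = ?g (simple_transposition x y)" for y by simp
  have "?g' x > ?g' (Suc x)" using Cons.prems(1) by (simp add: simple_transposition_apply)
  then have x: "\<not> (Suc c < x \<and> x < i)" using Cons.prems(4)[of x] by auto
  have x': "x \<noteq> c" "x \<noteq> i" using Cons.prems(2,3) by auto
  show ?case
  proof (cases "x = Suc c")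
    case False
    have "?g k < ?g (Suc k)" if "Suc c < k" "k < i" for k
      using Cons.prems(4)[OF that] x x' False that unfolding g'
      by (auto simp: simple_transposition_apply split: if_splits)
    then have "count_list xs j \<le> 1" using Cons.IH[of c j] Cons.prems by auto
    then show ?thesis using x x' False Cons.prems(5,6) by auto
  next
    case True
    have c: "c \<notin> set xs" and i: "i \<notin> set xs" using Cons.prems(2,3) by auto
    have "Suc c < i" using True x' Cons.prems(5,6) by auto
    have asc: "?g k < ?g (Suc k)" if "Suc (Suc c) < k" "k < i" for k
      using Cons.prems(4)[of k] that True unfolding g'
      by (auto simp: simple_transposition_apply split: if_splits)
    have first: "?g (Suc c) < ?g (Suc (Suc c))" using Cons.prems(1) True by simp
    have min: "?g (Suc c) \<le> ?g k" if "Suc c \<le> k" "k \<le> i" for k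
    proof (cases "k \<le> Suc (Suc c)")
      case True
      then have "k = Suc c \<or> k = Suc (Suc c)" using that by linarith
      then show ?thesis using first by auto
    next
      case False
      then have k: "Suc (Suc c) < k" by simp
      \<comment> \<open>Since \<open>x = c + 1\<close>, the value of \<open>?g'\<close> at
        \<open>c + 2\<close> is that of \<open>?g\<close> at \<open>c + 1\<close>.\<close>
      have "?g' (Suc (Suc c)) < ?g' k"
        by (rule ascents_imp_increasing[OF _ k]) (use Cons.prems(4) that in auto)
      then show ?thesis using k True unfolding g' by (simp add: simple_transposition_apply)
    qed
    have pres: "?g y \<le> c \<longleftrightarrow> y \<le> c" "?g y \<le> i \<longleftrightarrow> y \<le> i"
      "word_product xs y \<le> c \<longleftrightarrow> y \<le> c" "word_product xs y \<le> i \<longleftrightarrow> y \<le> i" for y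
      using word_product_le_iff[of c] word_product_le_iff[of i] c i by auto
    \<comment> \<open>The word permutes \<open>{c<..i}\<close>, so the value \<open>c + 1\<close> is
      attained there by \<open>?g\<close>; the minimum must be this smallest value.\<close>
    have "?g (Suc c) \<le> ?g (word_product xs (Suc c))"
      by (rule min) (use pres(3,4)[of "Suc c"] \<open>Suc c < i\<close> in auto)
    then have "?g (Suc c) \<le> Suc c" by simp
    then have fixed: "?g (Suc c) = Suc c" using pres(1)[of "Suc c"] by auto
    have "Suc c \<notin> set xs"
    proof
      assume "Suc c \<in> set xs"
      then obtain a b where ab: "a \<le> Suc c" "Suc c < b" "?g a > ?g b"
        using ascending_reaches_inversion[of xs "Suc c"] Cons.prems(1) by auto
      have "?g a \<le> Suc c"
        using ab(1) fixed pres(1)[of a] by (cases "a = Suc c") auto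
      moreover have "?g b > c" using pres(1)[of b] ab(2) by auto
      moreover have "?g b \<noteq> Suc c" using fixed ab(2) word_product_eq_iff[of "rev xs" b "Suc c"] by auto
      ultimately show False using ab(3) by auto
    qed
    moreover from this have "count_list xs j \<le> 1" if "j > Suc c"
      using Cons.IH[of "Suc c" j] that asc i Cons.prems(1,6) by auto
    ultimately show ?thesis using True Cons.prems(5) by (cases "j = Suc c") auto
  qed
qed

text \<open>A leading letter is a left descent, so none strictly between \<open>c\<close> and
  \<open>i\<close> can lead before \<open>c\<close> has been read. Afterwards \<open>c\<close> is
  absent and only \<open>c + 1\<close> can be a descent, which is the isolated case.\<close>

lemma count_le_1_interval_right:
  assumes "ascending xs" "count_list xs c \<le> 1" "i \<notin> set xs"
    and "\<And>j. c < j \<Longrightarrow> j < i \<Longrightarrow> word_product (rev xs) j < word_product (rev xs) (Suc j)"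
    and "c < j" "j < i"
  shows "count_list xs j \<le> 1"
  using assms
proof (induction xs)
  case Nil
  then show ?case by simp
next
  case (Cons x xs)
  let ?g = "word_product (rev xs)"
  let ?g' = "word_product (rev (x # xs))"
  have g': "?g' y = ?g (simple_transposition x y)" for y by simp
  have "?g' x > ?g' (Suc x)" using Cons.prems(1) by (simp add: simple_transposition_apply)
  then have x: "\<not> (c < x \<and> x < i)" using Cons.prems(4)[of x] by auto
  have "x \<noteq> i" using Cons.prems(3) by auto
  have asc: "?g k < ?g (Suc k)" if "c < k" "k < i" "x = c \<Longrightarrow> Suc c < k" for k
    using Cons.prems(4)[OF that(1,2)] x \<open>x \<noteq> i\<close> that unfolding g'
    by (auto simp: simple_transposition_apply split: if_splits)
  have "count_list xs j \<le> 1"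
  proof (cases "x = c")
    case True
    then have "c \<notin> set xs" using Cons.prems(2) by (auto simp: count_list_0_iff)
    then show ?thesis
      using count_le_1_isolated_interval[of xs c i j] asc Cons.prems by auto
  next
    case False
    then show ?thesis using Cons.IH asc Cons.prems by auto
  qed
  then show ?case using x Cons.prems(5,6) by auto
qed

section \<open>The diagram automorphism sending \<open>i\<close> to \<open>n - i\<close>\<close>

lemma simple_transposition_mirror:
  assumes "1 \<le> i" "i < n" "1 \<le> x" "x \<le> n"
  shows "simple_transposition (n - i) (Suc n - x) = Suc n - simple_transposition i x"
  using assms by (auto simp: simple_transposition_apply)

lemma word_product_range:
  assumes "set xs \<subseteq> {1..<n}" "1 \<le> x" "x \<le> n"
  shows "1 \<le> word_product xs x \<and> word_product xs x \<le> n"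
  using permutes_in_image[OF word_product_permutes[OF assms(1)], of x] assms(2,3) by auto

lemma word_product_mirror:
  assumes "set xs \<subseteq> {1..<n}" "1 \<le> x" "x \<le> n"
  shows "word_product (map (\<lambda>i. n - i) xs) (Suc n - x) = Suc n - word_product xs x"
  using assms
proof (induction xs)
  case (Cons i xs)
  then show ?case
    using simple_transposition_mirror[of i n "word_product xs x"] word_product_range[of xs n x]
    by simp
qed simp

text \<open>The reversal of \<open>{1..n}\<close> acts on positions and on values, and the two
  changes of order cancel.\<close>

lemma mirror_ascent:
  assumes "set xs \<subseteq> {1..<n}" "1 \<le> j" "j < n"
  shows "word_product (rev (map (\<lambda>i. n - i) xs)) (n - j)
        < word_product (rev (map (\<lambda>i. n - i) xs)) (Suc (n - j))
    \<longleftrightarrow> word_product (rev xs) j < word_product (rev xs) (Suc j)"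
  using word_product_mirror[of "rev xs" n j] word_product_mirror[of "rev xs" n "Suc j"] assms
    word_product_range[of "rev xs" n j] word_product_range[of "rev xs" n "Suc j"]
  by (auto simp: rev_map Suc_diff_le)

lemma ascending_mirror:
  assumes "set xs \<subseteq> {1..<n}" "ascending xs"
  shows "ascending (map (\<lambda>i. n - i) xs)"
  using assms mirror_ascent by (induction xs) auto

lemma count_list_mirror:
  fixes n :: nat
  assumes "set xs \<subseteq> {1..<n}" "j \<le> n"
  shows "count_list (map (\<lambda>i. n - i) xs) (n - j) = count_list xs j"
  using assms
proof (induction xs)
  case (Cons a xs)
  then have "n - a = n - j \<longleftrightarrow> a = j" by auto
  then show ?case using Cons by auto
qed simp

lemma count_le_1_interval_left:
  assumes "ascending xs" "set xs \<subseteq> {1..<n}" "count_list xs c \<le> 1" "i \<notin> set xs" "c \<le> n"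
    and "\<And>j. i < j \<Longrightarrow> j < c \<Longrightarrow> word_product (rev xs) j < word_product (rev xs) (Suc j)"
    and "i < j" "j < c"
  shows "count_list xs j \<le> 1"
proof -
  let ?xs = "map (\<lambda>i. n - i) xs"
  have "count_list ?xs (n - j) \<le> 1"
  proof (rule count_le_1_interval_right[of ?xs "n - c" "n - i"])
    show "ascending ?xs" using ascending_mirror assms by blast
    show "count_list ?xs (n - c) \<le> 1" using count_list_mirror[of xs n c] assms by simp
    show "n - i \<notin> set ?xs"
      using count_list_mirror[of xs n i] assms by (simp add: count_list_0_iff[symmetric] del: set_map)
    show "n - c < n - j" "n - j < n - i" using assms by auto
    fix k assume k: "n - c < k" "k < n - i"
    then have "word_product (rev xs) (n - k) < word_product (rev xs) (Suc (n - k))"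
      using assms(5) by (intro assms(6)) auto
    then show "word_product (rev ?xs) k < word_product (rev ?xs) (Suc k)"
      using mirror_ascent[of xs n "n - k"] k assms(2) by simp
  qed
  then show ?thesis using count_list_mirror[of xs n j] assms by simp
qed

section \<open>Coxeter elements\<close>

text \<open>A letter used exactly once sends some point across its cut for good; a word without that
  letter cannot.\<close>

lemma word_product_set_subset:
  assumes "distinct xs" "word_product ys = word_product xs"
  shows "set xs \<subseteq> set ys"
proof
  fix c assume "c \<in> set xs"
  then obtain us vs where xs: "xs = us @ c # vs" by (meson split_list)
  then have c: "c \<notin> set us" "c \<notin> set vs" using assms(1) by auto
  show "c \<in> set ys"
  proof (rule ccontr)
    assume "c \<notin> set ys"
    \<comment> \<open>The point that \<open>vs\<close> carries to \<open>c\<close>, just before the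
      letter \<open>c\<close> lifts it to \<open>c + 1\<close>.\<close>
    let ?x = "word_product (rev vs) c"
    have "word_product ys ?x > c"
      using word_product_le_iff[OF c(1), of "Suc c"]
      unfolding assms(2) xs by (simp add: simple_transposition_apply not_le)
    moreover have "?x \<le> c" using word_product_le_iff[of c "rev vs" c] c(2) by simp
    ultimately show False using word_product_le_iff[OF \<open>c \<notin> set ys\<close>, of ?x] by simp
  qed
qed

lemma distinct_word_minimal:
  assumes "distinct xs" "word_product ys = word_product xs"
  shows "length xs \<le> length ys"
  using card_mono[OF _ word_product_set_subset[OF assms]] card_length[of ys]
  by (simp add: distinct_card[OF assms(1)])

lemma ascending_if_minimal:
  assumes "\<And>ys. word_product ys = word_product xs \<Longrightarrow> length xs \<le> length ys"
  shows "ascending xs"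
  using not_ascending_shorten[of xs] assms by (meson not_less)

text \<open>The inverse is decreasing on \<open>{p<..q}\<close>, so every pair of these
  \<open>q - p\<close> points is an inversion.\<close>

lemma block_count_all_descents:
  assumes "ascending xs" "set xs \<subseteq> I" "p \<notin> I" "q \<notin> I" "{p<..<q} \<subseteq> I"
    and "\<forall>j\<in>I. word_product (rev xs) j > word_product (rev xs) (Suc j)"
  shows "block_count p q xs = (q - p) choose 2"
proof -
  have "word_product (rev xs) a > word_product (rev xs) b" if "p < a" "a < b" "b \<le> q" for a b
    using that assms(5) by (intro descents_imp_decreasing[OF assms(6)]) auto
  then have "{(a, b). p < a \<and> a < b \<and> b \<le> q \<and> word_product (rev xs) a > word_product (rev xs) b}
    = {(a, b). p < a \<and> a < b \<and> b \<le> q}"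
    by auto
  moreover have "p \<notin> set xs" "q \<notin> set xs" using assms by auto
  ultimately show ?thesis
    using block_count_conv_inversions[OF assms(1)] card_increasing_pairs by simp
qed

text \<open>
  If all letters of the block occur, the bound on their number leaves one occurrence for each.
  Otherwise a missing letter cuts the block into two intervals, each next to one of \<open>p\<close> and \<open>q\<close>.
\<close>

lemma count_le_1_block:
  assumes "ascending xs" "set xs \<subseteq> {1..<n}" "q \<le> n"
    and "count_list xs p \<le> 1" "count_list xs q \<le> 1"
    and "block_count p q xs \<le> card {p<..<q}"
    and asc: "\<And>j. p < j \<Longrightarrow> j < q \<Longrightarrow> word_product (rev xs) j < word_product (rev xs) (Suc j)"
    and "p < j" "j < q"
  shows "count_list xs j \<le> 1"
proof (cases "{p<..<q} \<subseteq> set xs")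
  case True
  have "(\<Sum>i\<in>{p<..<q}. count_list xs i) = count_list xs j + (\<Sum>i\<in>{p<..<q} - {j}. count_list xs i)"
    using assms(8,9) by (intro sum.remove) auto
  \<comment> \<open>Each of the other letters uses up at least one of the available places, which
    leaves at most one for \<open>j\<close>.\<close>
  moreover have "(\<Sum>i\<in>{p<..<q} - {j}. count_list xs i) \<ge> (\<Sum>i\<in>{p<..<q} - {j}. 1)"
    using True by (intro sum_mono) (auto simp: Suc_le_eq count_list_0_iff intro!: Nat.gr0I)
  ultimately have "count_list xs j + (card {p<..<q} - 1) \<le> card {p<..<q}"
    using assms(6,8,9) by (simp add: block_count_conv_sum)
  moreover have "card {p<..<q} \<ge> 1" using assms(8,9) by simp
  ultimately show ?thesis by linarith
next
  case False
  then obtain i where i: "p < i" "i < q" "i \<notin> set xs" using greaterThanLessThan_iff by blast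
  consider "j < i" | "j = i" | "i < j" by linarith
  then show ?thesis
  proof cases
    case 1
    show ?thesis
      by (rule count_le_1_interval_right[OF assms(1,4) i(3) _ assms(8) 1]) (use asc i in auto)
  next
    case 2
    then show ?thesis using i by simp
  next
    case 3
    show ?thesis
      by (rule count_le_1_interval_left[OF assms(1,2,5) i(3) assms(3) _ 3 assms(9)])
        (use asc i in auto)
  qed
qed

lemma distinct_iff_count_list: "distinct xs \<longleftrightarrow> (\<forall>x. count_list xs x \<le> 1)"
proof (induction xs)
  case (Cons y xs)
  show ?case
  proof
    assume "distinct (y # xs)"
    then show "\<forall>x. count_list (y # xs) x \<le> 1" using Cons by auto
  next
    assume *: "\<forall>x. count_list (y # xs) x \<le> 1"
    have "count_list xs x \<le> 1" for x using *[rule_format, of x] by (simp split: if_splits)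
    moreover have "y \<notin> set xs"
      using *[rule_format, of y] by (simp add: count_list_0_iff)
    ultimately show "distinct (y # xs)" using Cons by simp
  qed
qed simp

theorem theorem1p3:
  fixes n k :: nat and w :: "nat \<Rightarrow> nat" and I :: "nat set" and d :: "nat \<Rightarrow> nat"
  assumes "n \<ge> 1"
    and "w \<in> carrier (sym_group n)"
    and "I \<subseteq> left_descents n w"
    and "strict_mono_on {1..k} d"
    and "d ` {1..k} = {1..<n} - I"
    and "d 0 = 0"
    and "d (k + 1) = n"
  shows "(\<exists>K \<subseteq> {1..<n}. standard_coxeter_element K (longest_element n I \<circ> w))
     \<longleftrightarrow>
     (\<exists>is. reduced_expression n is w \<and>
        (\<forall>i \<in> {1..k}. card {m. m < length is \<and> is ! m = d i} \<le> 1) \<and>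
        (\<forall>t \<in> {1..k + 1}.
           card {m. m < length is \<and> d (t - 1) < is ! m \<and> is ! m < d t}
             < (d t - d (t - 1) + 1) choose 2))"
proof -

  \<comment> \<open>The blocks between consecutive values of \<open>d\<close>\<close>
  have I: "I \<subseteq> {1..<n}" and descents: "\<And>j. j \<in> I \<Longrightarrow> inv' w j > inv' w (Suc j)"
    using assms(3) by (auto simp: left_descents_def)
  have d_notin: "d t \<notin> I" if "t \<le> k + 1" for t
  proof -
    consider "t = 0" | "t \<in> {1..k}" | "t = k + 1" using \<open>t \<le> k + 1\<close> by fastforce
    then show ?thesis using assms(5-7) I by cases auto
  qed
  have d_bounds: "1 \<le> d t \<and> d t < n" if "t \<in> {1..k}" for t
    using assms(5) that by auto
  have d_mono: "d a < d b" if "a < b" "b \<le> k + 1" for a b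
  proof -
    have "a = 0 \<or> a \<in> {1..k}" "b = k + 1 \<or> b \<in> {1..k}" using that by auto
    then consider "a = 0" "b = k + 1" | "a = 0" "b \<in> {1..k}" | "a \<in> {1..k}" "b = k + 1"
      | "a \<in> {1..k}" "b \<in> {1..k}"
      by blast
    then show ?thesis
    proof cases
      case 4
      then show ?thesis using strict_mono_onD[OF assms(4)] that by blast
    qed (use d_bounds[of a] d_bounds[of b] assms(1,6,7) in auto)
  qed
  have block: "{d (t - 1)<..<d t} \<subseteq> I" if "t \<in> {1..k + 1}" for t
  proof
    fix j assume j: "j \<in> {d (t - 1)<..<d t}"
    have "d t \<le> n" using d_mono[of t "k + 1"] that assms(7) by (cases "t = k + 1") auto
    show "j \<in> I"
    proof (rule ccontr)
      assume "j \<notin> I"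
      moreover have "j \<in> {1..<n}" using j \<open>d t \<le> n\<close> by auto
      ultimately have "j \<in> d ` {1..k}" unfolding assms(5) by blast
      then obtain s where s: "s \<in> {1..k}" "j = d s" by blast
      have "s < t"
      proof (rule ccontr)
        assume "\<not> s < t"
        then have "s = t \<or> t < s" by auto
        then show False using s j d_mono[of t s] by auto
      qed
      moreover have "t - 1 < s"
      proof (rule ccontr)
        assume "\<not> t - 1 < s"
        then have "s = t - 1 \<or> s < t - 1" by auto
        moreover have "t - 1 \<le> k + 1" using that by auto
        ultimately show False using s j d_mono[of s "t - 1"] by auto
      qed
      ultimately show False by auto
    qed
  qed
  have in_block: "\<exists>t\<in>{1..k + 1}. d (t - 1) < j \<and> j < d t" if "j \<in> I" for j
  proof -
    \<comment> \<open>The right end of the block of \<open>j\<close>; the boundary value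
      \<open>d (k + 1) = n\<close> ensures that it exists.\<close>
    define t where "t = (LEAST t. j < d t)"
    have "j < d (k + 1)" using that I assms(7) by auto
    then have t: "j < d t" "t \<le> k + 1" unfolding t_def by (auto intro: LeastI Least_le)
    have "t \<noteq> 0" using t(1) assms(6) by (cases t) auto
    then have "\<not> j < d (t - 1)" using not_less_Least[of "t - 1" "\<lambda>t. j < d t"] t_def by auto
    moreover have "d (t - 1) \<noteq> j" using d_notin[of "t - 1"] t(2) that by fastforce
    ultimately show ?thesis using t \<open>t \<noteq> 0\<close> by (intro bexI[of _ t]) auto
  qed

  \<comment> \<open>Stripping the longest element of the parabolic subgroup\<close>
  obtain u where u: "ascending u" "set u \<subseteq> I" "word_product u = longest_element n I"
    "\<forall>j\<in>I. word_product (rev u) j > word_product (rev u) (Suc j)"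
    by (rule longest_element_word[OF I])
  have u_range: "set u \<subseteq> {1..<n}" using u(2) I by blast
  have u_count: "block_count (d (t - 1)) (d t) u = (d t - d (t - 1)) choose 2"
    if "t \<in> {1..k + 1}" for t
    by (rule block_count_all_descents[OF u(1,2) _ _ block[OF that] u(4)])
      (use that in \<open>auto intro!: d_notin\<close>)
  \<comment> \<open>With \<open>m = d t - d (t - 1)\<close> the block has \<open>m - 1\<close>
    letters. The strict bound in (S.2) thus leaves exactly \<open>m - 1\<close> places beyond those
    taken by \<open>u\<close>.\<close>
  have bound: "(d t - d (t - 1) + 1) choose 2 = ((d t - d (t - 1)) choose 2) + card {d (t - 1)<..<d t} + 1"
    if "t \<in> {1..k + 1}" for t
    using d_mono[of "t - 1" t] that by (auto simp: numeral_2_eq_2)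
  have card_conv: "card {m. m < length xs \<and> xs ! m = c} = count_list xs c"
    "card {m. m < length xs \<and> p < xs ! m \<and> xs ! m < q} = block_count p q xs" for xs :: "nat list" and c p q
    by (auto simp: block_count_def length_filter_conv_card count_list_eq_length_filter
        intro!: arg_cong[of _ _ card])
  have step: "\<exists>v. word_product v = longest_element n I \<circ> w \<and> length v + length u = length r
      \<and> set v \<subseteq> set r
      \<and> ((\<forall>c. c \<notin> I \<longrightarrow> count_list r c \<le> 1) \<longrightarrow> (\<forall>c. c \<notin> I \<longrightarrow> count_list v c \<le> 1)
        \<and> (\<forall>p q. p \<notin> I \<longrightarrow> q \<notin> I \<longrightarrow> block_count p q v + block_count p q u = block_count p q r))"
    if "word_product r = w" for r
    using strip_descents[OF u(1,2), of r] descents that u(3) by (simp add: inv_word_product[symmetric])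
  show ?thesis (is "?A \<longleftrightarrow> ?B")
  proof

    \<comment> \<open>From a Coxeter element to a reduced word\<close>
    assume ?A
    then obtain c where c: "distinct c" "set c \<subseteq> {1..<n}"
      "word_product c = longest_element n I \<circ> w"
      by (auto simp: standard_coxeter_element_def)
    let ?r = "rev u @ c"
    have "word_product ?r = w" by (auto simp: c(3) u(3)[symmetric])
    moreover have "ascending ?r"
    proof (rule ascending_if_minimal)
      \<comment> \<open>Stripping \<open>u\<close> from a competitor yields a word for the Coxeter
        element, which has at least \<open>length c\<close> letters.\<close>
      fix r assume "word_product r = word_product ?r"
      then obtain v where "word_product v = longest_element n I \<circ> w" "length v + length u = length r"
        using step[of r] \<open>word_product ?r = w\<close> by auto
      then show "length ?r \<le> length r" using distinct_word_minimal[OF c(1)] c(3) by fastforce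
    qed
    ultimately have "reduced_expression n ?r w"
      using c(2) u_range by (simp add: reduced_expression_iff_ascending)
    moreover have "count_list ?r (d i) \<le> 1" if "i \<in> {1..k}" for i
    proof -
      have "d i \<notin> set u" using d_notin[of i] that u(2) by auto
      then show ?thesis using c(1) by (simp add: distinct_iff_count_list)
    qed
    moreover have "block_count (d (t - 1)) (d t) ?r < (d t - d (t - 1) + 1) choose 2"
      if "t \<in> {1..k + 1}" for t
    proof -
      have "block_count (d (t - 1)) (d t) c \<le> (\<Sum>i\<in>{d (t - 1)<..<d t}. 1)"
        unfolding block_count_conv_sum using c(1) by (intro sum_mono) (simp add: distinct_iff_count_list)
      then show ?thesis using bound[OF that] u_count[OF that] by simp
    qed
    ultimately show ?B unfolding card_conv by blast
  next

    \<comment> \<open>From a reduced word to a Coxeter element\<close>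
    assume ?B
    then obtain r where r: "reduced_expression n r w"
      "\<And>i. i \<in> {1..k} \<Longrightarrow> count_list r (d i) \<le> 1"
      "\<And>t. t \<in> {1..k + 1} \<Longrightarrow> block_count (d (t - 1)) (d t) r < (d t - d (t - 1) + 1) choose 2"
      unfolding card_conv by blast
    have r': "set r \<subseteq> {1..<n}" "word_product r = w" "ascending r"
      using r(1) by (auto simp: reduced_expression_iff_ascending)
    have r_count: "count_list r c \<le> 1" if "c \<notin> I" for c
    proof (cases "c \<in> {1..<n}")
      case True
      then have "c \<in> d ` {1..k}" using that unfolding assms(5) by simp
      then obtain i where "i \<in> {1..k}" "c = d i" by (rule imageE)
      then show ?thesis using r(2) by blast
    next
      case False
      then have "c \<notin> set r" using r'(1) by blast
      then show ?thesis by simp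
    qed
    obtain v where v: "word_product v = longest_element n I \<circ> w" "length v + length u = length r"
      "set v \<subseteq> set r" "\<And>c. c \<notin> I \<Longrightarrow> count_list v c \<le> 1"
      "\<And>p q. p \<notin> I \<Longrightarrow> q \<notin> I \<Longrightarrow> block_count p q v + block_count p q u = block_count p q r"
      using step[OF r'(2)] r_count by blast
    have "ascending v"
    proof (rule ascending_if_minimal)
      \<comment> \<open>A word shorter than \<open>v\<close> would, after \<open>rev u\<close>, give
        a word for \<open>w\<close> shorter than the reduced word \<open>r\<close>.\<close>
      fix x assume "word_product x = word_product v"
      then have "word_product (rev u @ x) = word_product r"
        by (auto simp: v(1) u(3)[symmetric] r'(2))
      then show "length v \<le> length x" using ascending_minimal[OF r'(3), of "rev u @ x"] v(2) by simp
    qed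
    have v_inv: "word_product (rev v) = word_product (rev r) \<circ> word_product (rev u)"
      using word_product_rev_cong[of v "u @ r"] v(1) u(3) r'(2) by simp
    have asc: "word_product (rev v) j < word_product (rev v) (Suc j)" if "j \<in> I" for j
    proof -
      \<comment> \<open>The inverse of \<open>u\<close> descends at \<open>j\<close> within one
        block, and the inverse of \<open>r\<close> is decreasing on that block; two reversals give
        an ascent.\<close>
      have "{word_product (rev u) (Suc j)..<word_product (rev u) j} \<subseteq> I"
        by (rule word_product_block) (use u(2) in auto)
      moreover have "\<forall>j\<in>I. word_product (rev r) j > word_product (rev r) (Suc j)"
        using descents r'(2) by (simp add: inv_word_product[symmetric])
      ultimately show ?thesis
        unfolding v_inv using descents_imp_decreasing u(4) that by (metis comp_apply)
    qed
    have "count_list v j \<le> 1" for j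
    proof (cases "j \<in> I")
      case True
      then obtain t where t: "t \<in> {1..k + 1}" "d (t - 1) < j" "j < d t" using in_block by blast
      have notin: "d (t - 1) \<notin> I" "d t \<notin> I" using d_notin t(1) by auto
      show ?thesis
      proof (rule count_le_1_block[where p = "d (t - 1)" and q = "d t"])
        show "d t \<le> n" using d_mono[of t "k + 1"] t(1) assms(7) by (cases "t = k + 1") auto
        show "block_count (d (t - 1)) (d t) v \<le> card {d (t - 1)<..<d t}"
          using v(5)[OF notin] u_count[OF t(1)] bound[OF t(1)] r(3)[OF t(1)] by linarith
        show "word_product (rev v) i < word_product (rev v) (Suc i)"
          if "d (t - 1) < i" "i < d t" for i
          using asc block[OF t(1)] that by auto
      qed (use \<open>ascending v\<close> v(3,4) r'(1) notin t in auto)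
    qed (use v(4) in auto)
    then have "distinct v" by (simp add: distinct_iff_count_list)
    then show ?A using v(1,3) r'(1) by (auto simp: standard_coxeter_element_def)
  qed
qed

end
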